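(* Let $n,d\ge 1$ be integers. For Lebesgue-almost every $X=(x_1,\ldots,x_n)\in(\mathbb R^d)^n\cong\mathbb R^{nd}$, the nonparametric maximum likelihood estimator for $X$ is unique, i.e. there is exactly one Borel probability measure $\widehat\pi$ on $\mathbb R^d$ attaining the supremum $$\sup_{\pi\in\mathcal P(\mathbb R^d)}\ \sum_{i=1}^n\log p_\pi(x_i),\qquad p_\pi(x)=\int_{\mathbb R^d}\varphi_d(x-\theta)\,d\pi(\theta),\qquad \varphi_d(x)=(2\pi)^{-d/2}e^{-\|x\|^2/2}.$$
   Context: $\mathcal P(\mathbb R^d)$ denotes the set of Borel probability measures on $\mathbb R^d$; $\|\cdot\|$ is the Euclidean norm. In $\varphi_d$, the factor $(2\pi)^{-d/2}$ involves the number $\pi$, while elsewhere $\pi$ denotes a measure. A nonparametric maximum likelihood estimator (NPMLE) for a dataset $X$ is any $\widehat\pi\in\mathcal P(\mathbb R^d)$ attaining the displayed supremum. "Lebesgue-almost every $X$" means every $X$ outside a set of Lebesgue measure zero in $\mathbb R^{nd}$. *)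

theory Defs
  imports "HOL-Probability.Probability"
begin

definition gauss_density :: "real ^ 'd \<Rightarrow> real" where
  "gauss_density x = (2 * pi) powr (- real CARD('d) / 2) * exp (- (norm x)\<^sup>2 / 2)"

definition borel_prob_measures :: "(real ^ 'd) measure set" where
  "borel_prob_measures = {\<mu>. sets \<mu> = sets borel \<and> prob_space \<mu>}"

definition mixture_density :: "(real ^ 'd) measure \<Rightarrow> real ^ 'd \<Rightarrow> real" where
  "mixture_density \<mu> x = (\<integral>\<theta>. gauss_density (x - \<theta>) \<partial>\<mu>)"

definition log_likelihood :: "real ^ 'd ^ 'n \<Rightarrow> (real ^ 'd) measure \<Rightarrow> real" where
  "log_likelihood X \<mu> = (\<Sum>i\<in>UNIV. ln (mixture_density \<mu> (X $ i)))"

text \<open>The lemmas below show that the integral, the logarithm and the real-valued supremum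
  are all applied inside their proper domains.\<close>

definition is_npmle :: "real ^ 'd ^ 'n \<Rightarrow> (real ^ 'd) measure \<Rightarrow> bool" where
  "is_npmle X \<mu> \<longleftrightarrow> \<mu> \<in> borel_prob_measures \<and>
     log_likelihood X \<mu> = (SUP \<nu>\<in>borel_prob_measures. log_likelihood X \<nu>)"

lemma gauss_density_pos: "gauss_density x > 0"
  by (simp add: gauss_density_def)

lemma gauss_density_le:
  fixes x :: "real ^ 'd"
  shows "gauss_density x \<le> (2 * pi) powr (- real CARD('d) / 2)"
  by (simp add: gauss_density_def mult_left_le)

lemma integrable_gauss_density:
  fixes \<mu> :: "(real ^ 'd) measure"
  assumes "\<mu> \<in> borel_prob_measures"
  shows "integrable \<mu> (\<lambda>\<theta>. gauss_density (x - \<theta>))"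
proof -
  interpret prob_space \<mu>
    using assms by (simp add: borel_prob_measures_def)
  have [measurable_cong]: "sets \<mu> = sets borel"
    using assms by (simp add: borel_prob_measures_def)
  show ?thesis
  proof (rule integrable_const_bound[where B = "(2 * pi) powr (- real CARD('d) / 2)"])
    show "AE \<theta> in \<mu>. norm (gauss_density (x - \<theta>)) \<le> (2 * pi) powr (- real CARD('d) / 2)"
      by (rule AE_I2) (simp only: real_norm_def abs_of_pos[OF gauss_density_pos] gauss_density_le)
    show "(\<lambda>\<theta>. gauss_density (x - \<theta>)) \<in> borel_measurable \<mu>"
      unfolding gauss_density_def by measurable
  qed
qed

lemma mixture_density_pos:
  assumes "\<mu> \<in> borel_prob_measures"
  shows "mixture_density \<mu> x > 0"
proof -
  interpret prob_space \<mu>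
    using assms by (simp add: borel_prob_measures_def)
  have "(\<integral>\<theta>. 0 \<partial>\<mu>) < (\<integral>\<theta>. gauss_density (x - \<theta>) \<partial>\<mu>)"
    by (rule integral_less_AE_space)
       (use assms integrable_gauss_density gauss_density_pos emeasure_space_1 in auto)
  then show ?thesis
    by (simp add: mixture_density_def)
qed

lemma mixture_density_le:
  fixes \<mu> :: "(real ^ 'd) measure"
  assumes "\<mu> \<in> borel_prob_measures"
  shows "mixture_density \<mu> x \<le> (2 * pi) powr (- real CARD('d) / 2)"
proof -
  interpret prob_space \<mu>
    using assms by (simp add: borel_prob_measures_def)
  show ?thesis
    unfolding mixture_density_def
    by (rule integral_le_const[OF integrable_gauss_density[OF assms]])
       (use gauss_density_le in auto)
qed

lemma borel_prob_measures_nonempty: "borel_prob_measures \<noteq> {}"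
proof -
  have "return borel 0 \<in> borel_prob_measures"
    by (simp add: borel_prob_measures_def prob_space_return)
  then show ?thesis by blast
qed

lemma bdd_above_log_likelihood:
  fixes X :: "real ^ 'd ^ 'n"
  shows "bdd_above (log_likelihood X ` borel_prob_measures)"
proof (rule bdd_aboveI2)
  fix \<mu> :: "(real ^ 'd) measure"
  assume "\<mu> \<in> borel_prob_measures"
  then show "log_likelihood X \<mu> \<le> (\<Sum>i\<in>(UNIV :: 'n set). ln ((2 * pi) powr (- real CARD('d) / 2)))"
    unfolding log_likelihood_def
    by (intro sum_mono ln_mono mixture_density_pos mixture_density_le)
qed

end

theory Submission
  imports Defs
begin

text \<open>
  Adding \<open>\<parallel>X\<parallel>\<^sup>2 / 2\<close> to the maximal log-likelihood gives a convex function of \<open>X\<close>, namely a supremum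
  of sums of \<open>ln \<integral> exp (x\<^sub>i \<bullet> \<theta> - \<parallel>\<theta>\<parallel>\<^sup>2 / 2) d\<pi>(\<theta>)\<close>, so for almost every \<open>X\<close> it has a single subgradient.
  The posterior means of every maximizer form a subgradient, hence all maximizers share their posterior
  means, besides their fitted likelihoods \<open>p\<^sub>i\<close>.

  Let \<open>\<mu>\<close>, \<open>\<nu>\<close> be two maximizers. If \<open>f\<close> is small and \<open>f d\<mu>\<close>, \<open>f d\<nu>\<close> give the same integrals against all
  likelihoods, then \<open>(1/2 \<plusminus> f) d\<mu> + (1/2 \<mp> f) d\<nu>\<close> are maximizers too. Equality of their posterior means
  says that the class of such \<open>f\<close> is closed under multiplication by coordinates, so it contains all
  polynomials. As \<open>\<mu>\<close> and \<open>\<nu>\<close> have bounded support, they coincide.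
\<close>

section \<open>Subgradients\<close>

text \<open>Within a box, the translates of the set by \<open>e / (k + 1)\<close> are pairwise
  disjoint, have equal measure and all fit into one ball. Infinitely many of them leave room only
  for measure zero.\<close>

lemma negligible_closed_lines_meet_once:
  fixes S :: "'a::euclidean_space set"
  assumes "closed S" and once: "\<And>x t. \<lbrakk>x \<in> S; x + t *\<^sub>R e \<in> S\<rbrakk> \<Longrightarrow> t = 0"
  shows "negligible S"
proof (rule negligible_on_intervals[THEN iffD2, rule_format])
  fix a b :: 'a
  define T where "T = S \<inter> cbox a b"
  have T: "compact T"
    unfolding T_def by (rule closed_Int_compact[OF assms(1) compact_cbox])
  then have Tm: "T \<in> lmeasurable" by (rule lmeasurable_compact)
  define U where "U = (\<lambda>k::nat. (+) ((1 / real (Suc k)) *\<^sub>R e) ` T)"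
  obtain B where B: "\<And>x. x \<in> T \<Longrightarrow> norm x \<le> B"
    using compact_imp_bounded[OF T] by (auto simp: bounded_iff)
  have Um: "U k \<in> lmeasurable" for k
    unfolding U_def by (rule measurable_translation[OF Tm])
  have disj: "disjoint_family_on U {..<n}" for n
  proof (unfold disjoint_family_on_def, intro ballI impI, rule ccontr)
    fix j k assume "j \<noteq> k" "U j \<inter> U k \<noteq> {}"
    then obtain x y where xy: "x \<in> T" "y \<in> T"
      and eq: "(1 / real (Suc j)) *\<^sub>R e + x = (1 / real (Suc k)) *\<^sub>R e + y"
      by (auto simp: U_def)
    have "y = x + (1 / real (Suc j) - 1 / real (Suc k)) *\<^sub>R e"
      using eq by (simp add: algebra_simps)
    then have "1 / real (Suc j) - 1 / real (Suc k) = 0"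
      using xy by (intro once[of x]) (simp_all only: T_def Int_iff)
    then show False using \<open>j \<noteq> k\<close> by (simp add: right_minus_eq)
  qed
  have sub: "(\<Union>k\<in>{..<n}. U k) \<subseteq> cball 0 (norm e + B)" for n
  proof
    fix y assume "y \<in> (\<Union>k\<in>{..<n}. U k)"
    then obtain k x where k: "x \<in> T" "y = (1 / real (Suc k)) *\<^sub>R e + x"
      by (auto simp: U_def)
    have "norm y \<le> norm ((1 / real (Suc k)) *\<^sub>R e) + norm x"
      unfolding k(2) by (rule norm_triangle_ineq)
    also have "\<dots> \<le> norm e + B"
      using B[OF k(1)] by (intro add_mono) (auto simp: divide_le_eq algebra_simps)
    finally show "y \<in> cball 0 (norm e + B)" by simp
  qed
  have "real n * measure lebesgue T \<le> measure lebesgue (cball 0 (norm e + B) :: 'a set)" for n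
  proof -
    have "real n * measure lebesgue T = (\<Sum>k<n. measure lebesgue (U k))"
      by (simp add: U_def measure_translation)
    also have "\<dots> = measure lebesgue (\<Union>k\<in>{..<n}. U k)"
    proof (rule measure_finite_Union[symmetric])
      show "U ` {..<n} \<subseteq> sets lebesgue"
        using fmeasurableD[OF Um] by auto
      show "emeasure lebesgue (U i) \<noteq> \<infinity>" for i
        using fmeasurableD2[OF Um] by simp
    qed (use disj in simp_all)
    also have "\<dots> \<le> measure lebesgue (cball 0 (norm e + B) :: 'a set)"
      by (rule measure_mono_fmeasurable[OF sub])
         (intro sets.finite_UN fmeasurableD[OF Um] finite_lessThan, simp)
    finally show ?thesis .
  qed
  then have "measure lebesgue T = 0"
    by (metis measure_nonneg linorder_not_less order_le_less reals_Archimedean3)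
  then show "negligible (S \<inter> cbox a b)"
    using Tm by (simp add: negligible_iff_measure T_def)
qed

definition subgradient :: "('a::real_inner \<Rightarrow> real) \<Rightarrow> 'a \<Rightarrow> 'a \<Rightarrow> bool" where
  "subgradient f x m \<longleftrightarrow> (\<forall>y. f x + m \<bullet> (y - x) \<le> f y)"

text \<open>Averaging the affine minorant that touches \<open>f\<close> at a convex combination
  \<open>z\<close> over the two endpoints cancels its linear term and leaves
  \<open>f z\<close>.\<close>

lemma convex_on_if_subgradients:
  fixes f :: "'a::real_inner \<Rightarrow> real"
  assumes "\<And>x. \<exists>m. subgradient f x m"
  shows "convex_on UNIV f"
proof (intro convex_onI convex_UNIV)
  fix t :: real and x y :: 'a
  assume t: "0 < t" "t < 1"
  define z where "z = (1 - t) *\<^sub>R x + t *\<^sub>R y"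
  obtain m where m: "\<And>y. f z + m \<bullet> (y - z) \<le> f y"
    using assms by (auto simp: subgradient_def)
  have "(1 - t) * (f z + m \<bullet> (x - z)) + t * (f z + m \<bullet> (y - z)) \<le> (1 - t) * f x + t * f y"
    using m t by (intro add_mono mult_left_mono) auto
  moreover have "(1 - t) * (f z + m \<bullet> (x - z)) + t * (f z + m \<bullet> (y - z))
      = f z + m \<bullet> ((1 - t) *\<^sub>R (x - z) + t *\<^sub>R (y - z))"
    by (simp add: inner_add_right algebra_simps)
  moreover have "(1 - t) *\<^sub>R (x - z) + t *\<^sub>R (y - z) = 0"
    by (simp add: z_def algebra_simps)
  ultimately show "f ((1 - t) *\<^sub>R x + t *\<^sub>R y) \<le> (1 - t) * f x + t * f y"
    by (simp add: z_def)
qed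

text \<open>Distinct subgradients differ along some basis vector \<open>e\<close>, so two rationals
  \<open>q < r\<close> separate the one-sided slopes along \<open>e\<close>. For each of the
  countably many triples, the points with such a kink form a closed set that meets every line
  parallel to \<open>e\<close> at most once.\<close>

lemma AE_subgradient_unique:
  fixes f :: "'a::euclidean_space \<Rightarrow> real"
  assumes "\<And>x. \<exists>m. subgradient f x m"
  shows "AE x in lebesgue. \<forall>m m'. subgradient f x m \<longrightarrow> subgradient f x m' \<longrightarrow> m = m'"
proof -
  \<comment> \<open>A finite convex function on the whole space is continuous, which makes the kink
    sets closed.\<close>
  have cont: "continuous_on UNIV f"
    by (rule convex_on_continuous[OF open_UNIV convex_on_if_subgradients[OF assms]])
  have cont': "continuous_on UNIV (\<lambda>x. f (x + c))" for c
    by (rule continuous_on_compose2[OF cont]) (auto intro!: continuous_intros)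
  \<comment> \<open>The left slope along \<open>e\<close> is at most \<open>q\<close> and the right slope at least \<open>r\<close>.\<close>
  define N where "N = (\<lambda>e q r. {x. \<forall>s>0. f x + r * s \<le> f (x + s *\<^sub>R e) \<and> f x - q * s \<le> f (x + (- s) *\<^sub>R e)})"
  have "negligible (N e q r)" if "q < r" for e q r
  proof (rule negligible_closed_lines_meet_once)
    have "N e q r = (\<Inter>s\<in>{0<..}. {x. f x + r * s \<le> f (x + s *\<^sub>R e)} \<inter> {x. f x - q * s \<le> f (x + (- s) *\<^sub>R e)})"
      unfolding N_def by blast
    also have "closed \<dots>"
      by (intro closed_INT ballI closed_Int closed_Collect_le continuous_intros cont cont')
    finally show "closed (N e q r)" .
    \<comment> \<open>The right slope at \<open>x\<close> and the left slope at \<open>y\<close>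
      both bound the same secant, one from below by \<open>r\<close> and one from above by
      \<open>q\<close>.\<close>
    have *: False if "x \<in> N e q r" "y \<in> N e q r" "t > 0" "y = x + t *\<^sub>R e" for x y t
    proof -
      have "f x + r * t \<le> f y" "f y - q * t \<le> f x"
        using that by (auto simp: N_def dest!: spec[of _ t])
      then have "r * t \<le> q * t" by simp
      then show False using \<open>t > 0\<close> \<open>q < r\<close> by simp
    qed
    show "t = 0" if "x \<in> N e q r" "x + t *\<^sub>R e \<in> N e q r" for x t
    proof (rule ccontr)
      assume "t \<noteq> 0"
      then consider "t > 0" | "- t > 0" by linarith
      then show False
      proof cases
        case 1
        then show False using *[OF that] by blast
      next
        case 2
        then show False using *[OF that(2,1) 2] by simp
      qed
    qed
  qed
  then have null: "N e q r \<in> null_sets lebesgue" if "q < r" for e q r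
    using that by (simp add: negligible_iff_null_sets)
  have "countable {(q, r). q \<in> \<rat> \<and> r \<in> \<rat> \<and> q < (r::real)}"
    by (rule countable_subset[of _ "\<rat> \<times> \<rat>"]) (auto simp: countable_rat)
  then have neg: "(\<Union>e\<in>Basis. \<Union>qr\<in>{(q, r). q \<in> \<rat> \<and> r \<in> \<rat> \<and> q < r}. N e (fst qr) (snd qr))
      \<in> null_sets lebesgue"
  proof (intro null_sets_UN')
    show "countable (Basis :: 'a set)" by (simp add: countable_finite)
    show "N e (fst qr) (snd qr) \<in> null_sets lebesgue"
      if "qr \<in> {(q, r). q \<in> \<rat> \<and> r \<in> \<rat> \<and> q < r}" for e qr
      using that by (intro null) auto
  qed
  show ?thesis
  proof (rule AE_I')
    show "(\<Union>e\<in>Basis. \<Union>qr\<in>{(q, r). q \<in> \<rat> \<and> r \<in> \<rat> \<and> q < r}. N e (fst qr) (snd qr)) \<in> null_sets lebesgue"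
      by (rule neg)
    \<comment> \<open>The smaller slope \<open>m \<bullet> e\<close> controls steps to the left, the
      larger one \<open>m' \<bullet> e\<close> steps to the right.\<close>
    have *: "\<exists>qr\<in>{(q, r). q \<in> \<rat> \<and> r \<in> \<rat> \<and> q < r}. x \<in> N e (fst qr) (snd qr)"
      if m: "subgradient f x m" "subgradient f x m'" "m \<bullet> e < m' \<bullet> e" for x m m' e
    proof -
      obtain q where q: "q \<in> \<rat>" "m \<bullet> e < q" "q < m' \<bullet> e"
        using Rats_dense_in_real[OF m(3)] by blast
      obtain r where r: "r \<in> \<rat>" "q < r" "r < m' \<bullet> e"
        using Rats_dense_in_real[OF q(3)] by blast
      have "f x + r * s \<le> f (x + s *\<^sub>R e)" if "s > 0" for s
      proof -
        have "f x + m' \<bullet> (x + s *\<^sub>R e - x) \<le> f (x + s *\<^sub>R e)"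
          using m(2) unfolding subgradient_def by blast
        moreover have "s * r \<le> s * (m' \<bullet> e)"
          using that r by simp
        ultimately show ?thesis by (simp add: algebra_simps)
      qed
      moreover have "f x - q * s \<le> f (x + (- s) *\<^sub>R e)" if "s > 0" for s
      proof -
        have "f x + m \<bullet> (x + (- s) *\<^sub>R e - x) \<le> f (x + (- s) *\<^sub>R e)"
          using m(1) unfolding subgradient_def by blast
        moreover have "s * (m \<bullet> e) \<le> s * q"
          using that q by simp
        ultimately show ?thesis by (simp add: algebra_simps)
      qed
      ultimately have "x \<in> N e q r" by (simp add: N_def)
      then show ?thesis using q r by (intro bexI[of _ "(q, r)"]) auto
    qed
    show "{x \<in> space lebesgue. \<not> (\<forall>m m'. subgradient f x m \<longrightarrow> subgradient f x m' \<longrightarrow> m = m')}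
      \<subseteq> (\<Union>e\<in>Basis. \<Union>qr\<in>{(q, r). q \<in> \<rat> \<and> r \<in> \<rat> \<and> q < r}. N e (fst qr) (snd qr))"
    proof
      fix x assume "x \<in> {x \<in> space lebesgue. \<not> (\<forall>m m'. subgradient f x m \<longrightarrow> subgradient f x m' \<longrightarrow> m = m')}"
      then obtain m m' where m: "subgradient f x m" "subgradient f x m'" and "m \<noteq> m'"
        by blast
      then obtain e where e: "e \<in> Basis" "m \<bullet> e \<noteq> m' \<bullet> e"
        by (metis euclidean_eqI)
      then have "\<exists>qr\<in>{(q, r). q \<in> \<rat> \<and> r \<in> \<rat> \<and> q < r}. x \<in> N e (fst qr) (snd qr)"
        using *[OF m, of e] *[OF m(2,1), of e] by linarith
      then show "x \<in> (\<Union>e\<in>Basis. \<Union>qr\<in>{(q, r). q \<in> \<rat> \<and> r \<in> \<rat> \<and> q < r}. N e (fst qr) (snd qr))"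
        using e(1) by blast
    qed
  qed
qed

section \<open>Gaussian likelihoods and mean functionals\<close>

definition bounded_borel :: "('a::topological_space \<Rightarrow> real) \<Rightarrow> bool" where
  "bounded_borel f \<longleftrightarrow> f \<in> borel_measurable borel \<and> (\<exists>B. \<forall>x. \<bar>f x\<bar> \<le> B)"

lemma bounded_borelI:
  "f \<in> borel_measurable borel \<Longrightarrow> (\<And>x. \<bar>f x\<bar> \<le> B) \<Longrightarrow> bounded_borel f"
  by (auto simp: bounded_borel_def)

lemma bounded_borel_const: "bounded_borel (\<lambda>_. c)"
  by (rule bounded_borelI[where B = "\<bar>c\<bar>"]) auto

lemma bounded_borel_add:
  assumes "bounded_borel f" "bounded_borel g"
  shows "bounded_borel (\<lambda>x. f x + g x)"
proof -
  obtain A B where "\<And>x. \<bar>f x\<bar> \<le> A" "\<And>x. \<bar>g x\<bar> \<le> B"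
    using assms by (auto simp: bounded_borel_def)
  then have "\<bar>f x + g x\<bar> \<le> A + B" for x
    by (meson abs_triangle_ineq add_mono order_trans)
  then show ?thesis
    using assms by (intro bounded_borelI[where B = "A + B"]) (auto simp: bounded_borel_def)
qed

lemma bounded_borel_mult:
  assumes "bounded_borel f" "bounded_borel g"
  shows "bounded_borel (\<lambda>x. f x * g x)"
proof -
  obtain A B where AB: "\<And>x. \<bar>f x\<bar> \<le> A" "\<And>x. \<bar>g x\<bar> \<le> B"
    using assms by (auto simp: bounded_borel_def)
  have "\<bar>f x * g x\<bar> \<le> A * B" for x
    unfolding abs_mult using AB[of x] by (intro mult_mono) auto
  then show ?thesis
    using assms by (intro bounded_borelI[where B = "A * B"]) (auto simp: bounded_borel_def)
qed

lemma bounded_borel_cmult: "bounded_borel f \<Longrightarrow> bounded_borel (\<lambda>x. c * f x)"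
  by (intro bounded_borel_mult bounded_borel_const)

lemma bounded_borel_diff:
  "bounded_borel f \<Longrightarrow> bounded_borel g \<Longrightarrow> bounded_borel (\<lambda>x. f x - g x)"
  using bounded_borel_add[OF _ bounded_borel_cmult, of f g "-1"] by simp

lemma bounded_borel_divide: "bounded_borel f \<Longrightarrow> bounded_borel (\<lambda>x. f x / c)"
  using bounded_borel_cmult[of f "1 / c"] by simp

lemma bounded_borel_sum:
  "(\<And>i. i \<in> I \<Longrightarrow> bounded_borel (f i)) \<Longrightarrow> bounded_borel (\<lambda>x. \<Sum>i\<in>I. f i x)"
  by (induction I rule: infinite_finite_induct)
     (auto intro: bounded_borel_const bounded_borel_add)

lemma integrable_bounded_borel:
  assumes "prob_space \<mu>" "sets \<mu> = sets borel" "bounded_borel f"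
  shows "integrable \<mu> f"
proof -
  interpret prob_space \<mu> by fact
  obtain B where "\<And>x. \<bar>f x\<bar> \<le> B"
    using assms(3) by (auto simp: bounded_borel_def)
  then show ?thesis
    using assms(2,3) measurable_cong_sets[OF assms(2) refl, of borel]
    by (intro integrable_const_bound[where B = B]) (auto simp: bounded_borel_def)
qed

section \<open>Gaussian likelihoods as functions of the location parameter\<close>

abbreviation gauss_at :: "real ^ 'd \<Rightarrow> real ^ 'd \<Rightarrow> real" where
  "gauss_at x \<equiv> (\<lambda>\<theta>. gauss_density (x - \<theta>))"

lemma bounded_borel_gauss: "bounded_borel (gauss_at (x :: real ^ 'd))"
proof (rule bounded_borelI)
  show "gauss_at x \<in> borel_measurable borel"
    unfolding gauss_density_def by measurable
  show "\<bar>gauss_at x \<theta>\<bar> \<le> (2 * pi) powr (- real CARD('d) / 2)" for \<theta>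
    using gauss_density_le[of "x - \<theta>"] gauss_density_pos[of "x - \<theta>"] by simp
qed

lemma gauss_density_less:
  fixes x y :: "real ^ 'd"
  shows "norm x < norm y \<Longrightarrow> gauss_density y < gauss_density x"
  by (auto simp: gauss_density_def power_strict_mono)

text \<open>Expanding the square shows that, after removing a factor depending only on the
  observation, moving the observation is an exponential tilt in \<theta>. This is the source of
  convexity in the data.\<close>

lemma gauss_tilt:
  "gauss_at y \<theta> * exp ((norm y)\<^sup>2 / 2)
    = gauss_at x \<theta> * exp ((norm x)\<^sup>2 / 2) * exp ((y - x) \<bullet> \<theta>)"
proof -
  have "- (norm (y - \<theta>))\<^sup>2 / 2 + (norm y)\<^sup>2 / 2
      = - (norm (x - \<theta>))\<^sup>2 / 2 + (norm x)\<^sup>2 / 2 + (y - x) \<bullet> \<theta>"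
    by (simp add: power2_norm_eq_inner algebra_simps inner_commute) (simp add: field_simps)
  then show ?thesis
    unfolding gauss_density_def mult.assoc exp_add[symmetric] by simp
qed

text \<open>By \<open>\<bar>s\<bar> \<le> exp s + exp (- s)\<close>, the product is dominated by two
  exponential tilts of the likelihood, and these are multiples of the bounded likelihoods at
  \<open>x + h\<close> and \<open>x - h\<close>.\<close>

lemma bounded_borel_inner_gauss: "bounded_borel (\<lambda>\<theta>. (h \<bullet> \<theta>) * gauss_at x \<theta>)"
proof -
  have tilt: "exp (h' \<bullet> \<theta>) * gauss_at x \<theta>
      = exp ((norm (x + h'))\<^sup>2 / 2 - (norm x)\<^sup>2 / 2) * gauss_at (x + h') \<theta>" for h' \<theta>
    using gauss_tilt[of "x + h'" \<theta> x]
    by (simp only: exp_diff) (simp add: nonzero_eq_divide_eq nonzero_divide_eq_eq mult_ac)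
  have "bounded_borel (\<lambda>\<theta>. exp (h \<bullet> \<theta>) * gauss_at x \<theta> + exp ((- h) \<bullet> \<theta>) * gauss_at x \<theta>)"
    unfolding tilt by (intro bounded_borel_add bounded_borel_cmult bounded_borel_gauss)
  then obtain B where B: "\<And>\<theta>. \<bar>exp (h \<bullet> \<theta>) * gauss_at x \<theta> + exp ((- h) \<bullet> \<theta>) * gauss_at x \<theta>\<bar> \<le> B"
    by (auto simp: bounded_borel_def)
  show ?thesis
  proof (rule bounded_borelI)
    show "(\<lambda>\<theta>. (h \<bullet> \<theta>) * gauss_at x \<theta>) \<in> borel_measurable borel"
      unfolding gauss_density_def by measurable
    fix \<theta>
    have "\<bar>s\<bar> \<le> exp s + exp (- s)" for s :: real
      using exp_ge_add_one_self[of s] exp_ge_add_one_self[of "- s"]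
        exp_gt_zero[of s] exp_gt_zero[of "- s"] by linarith
    then have "\<bar>(h \<bullet> \<theta>) * gauss_at x \<theta>\<bar> \<le> (exp (h \<bullet> \<theta>) + exp (- (h \<bullet> \<theta>))) * gauss_at x \<theta>"
      unfolding abs_mult using gauss_density_pos[of "x - \<theta>"] by (simp add: abs_of_pos)
    also have "\<dots> \<le> B"
      using B[of \<theta>] by (simp add: algebra_simps)
    finally show "\<bar>(h \<bullet> \<theta>) * gauss_at x \<theta>\<bar> \<le> B" .
  qed
qed

lemma bounded_borel_nth_gauss: "bounded_borel (\<lambda>\<theta>. \<theta> $ a * gauss_at x \<theta>)"
  using bounded_borel_inner_gauss[of "axis a 1" x] by (simp add: inner_axis')

text \<open>Expectations as abstract functionals: reweighted averages of two measures are then available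
  without constructing a sum of measures.\<close>

locale mean_functional =
  fixes J :: "('a::topological_space \<Rightarrow> real) \<Rightarrow> real"
  assumes J_one: "J (\<lambda>_. 1) = 1"
    and J_add: "\<And>f g. bounded_borel f \<Longrightarrow> bounded_borel g \<Longrightarrow> J (\<lambda>x. f x + g x) = J f + J g"
    and J_cmult: "\<And>c f. bounded_borel f \<Longrightarrow> J (\<lambda>x. c * f x) = c * J f"
    and J_nonneg: "\<And>f. bounded_borel f \<Longrightarrow> (\<And>x. 0 \<le> f x) \<Longrightarrow> 0 \<le> J f"
begin

lemma J_const: "J (\<lambda>_. c) = c"
  using J_cmult[of "\<lambda>_. 1" c] by (simp add: J_one bounded_borel_const)

lemma J_diff: "bounded_borel f \<Longrightarrow> bounded_borel g \<Longrightarrow> J (\<lambda>x. f x - g x) = J f - J g"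
  using J_add[OF _ bounded_borel_cmult, of f g "-1"] J_cmult[of g "-1"] by simp

lemma J_mono:
  "bounded_borel f \<Longrightarrow> bounded_borel g \<Longrightarrow> (\<And>x. f x \<le> g x) \<Longrightarrow> J f \<le> J g"
  using J_nonneg[of "\<lambda>x. g x - f x"] by (simp add: J_diff bounded_borel_diff)

lemma J_sum:
  "(\<And>i. i \<in> I \<Longrightarrow> bounded_borel (f i)) \<Longrightarrow> J (\<lambda>x. \<Sum>i\<in>I. f i x) = (\<Sum>i\<in>I. J (f i))"
  by (induction I rule: infinite_finite_induct)
     (auto simp: J_const J_add bounded_borel_sum)

end

lemma mean_functional_integral:
  assumes "\<mu> \<in> borel_prob_measures"
  shows "mean_functional (integral\<^sup>L \<mu>)"
proof -
  interpret prob_space \<mu> using assms by (simp add: borel_prob_measures_def)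
  have "integrable \<mu> f" if "bounded_borel f" for f
    using integrable_bounded_borel prob_space_axioms assms that
    by (auto simp: borel_prob_measures_def)
  then show ?thesis
    by unfold_locales (auto simp: prob_space)
qed

text \<open>Jensen's inequality, via \<open>exp s \<ge> exp c * (1 + s - c)\<close> with \<open>c\<close> the
  tilted mean of \<open>s\<close>.\<close>

lemma mean_gauss_tilt:
  fixes x y :: "real ^ 'd"
  assumes "mean_functional J" and pos: "0 < J (gauss_at x)"
  shows "J (gauss_at x) * exp ((norm x)\<^sup>2 / 2)
      * exp (J (\<lambda>\<theta>. ((y - x) \<bullet> \<theta>) * gauss_at x \<theta>) / J (gauss_at x))
    \<le> J (gauss_at y) * exp ((norm y)\<^sup>2 / 2)"
proof -
  interpret mean_functional J by fact
  define s where "s = (\<lambda>\<theta>. (y - x) \<bullet> \<theta>)"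
  define c where "c = J (\<lambda>\<theta>. s \<theta> * gauss_at x \<theta>) / J (gauss_at x)"
  define E where "E = exp ((norm x)\<^sup>2 / 2) * exp c"
  have s: "bounded_borel (\<lambda>\<theta>. s \<theta> * gauss_at x \<theta>)"
    unfolding s_def by (rule bounded_borel_inner_gauss)
  note bb = s bounded_borel_gauss bounded_borel_add bounded_borel_cmult
  have "J (\<lambda>\<theta>. E * ((1 - c) * gauss_at x \<theta> + s \<theta> * gauss_at x \<theta>))
      = E * ((1 - c) * J (gauss_at x) + J (\<lambda>\<theta>. s \<theta> * gauss_at x \<theta>))"
    by (simp add: J_cmult J_add bb)
  \<comment> \<open>Since \<open>c\<close> is the tilted mean of \<open>s\<close>, the first-order
    terms cancel.\<close>
  also have "\<dots> = E * J (gauss_at x)"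
    using pos by (simp add: c_def field_simps)
  finally have "E * J (gauss_at x) = J (\<lambda>\<theta>. E * ((1 - c) * gauss_at x \<theta> + s \<theta> * gauss_at x \<theta>))" ..
  also have "\<dots> \<le> J (\<lambda>\<theta>. exp ((norm y)\<^sup>2 / 2) * gauss_at y \<theta>)"
  proof (intro J_mono bb)
    fix \<theta>
    have "exp c * (1 + (s \<theta> - c)) \<le> exp c * exp (s \<theta> - c)"
      by (intro mult_left_mono exp_ge_add_one_self) auto
    then have "exp c * (1 + (s \<theta> - c)) \<le> exp (s \<theta>)"
      by (simp add: exp_diff)
    then have "(gauss_at x \<theta> * exp ((norm x)\<^sup>2 / 2)) * (exp c * (1 + (s \<theta> - c)))
        \<le> (gauss_at x \<theta> * exp ((norm x)\<^sup>2 / 2)) * exp (s \<theta>)"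
      using gauss_density_pos[of "x - \<theta>"] by (intro mult_left_mono) auto
    also have "\<dots> = exp ((norm y)\<^sup>2 / 2) * gauss_at y \<theta>"
      using gauss_tilt[of y \<theta> x] by (simp add: s_def mult.commute[of "exp ((norm y)\<^sup>2 / 2)"])
    finally show "E * ((1 - c) * gauss_at x \<theta> + s \<theta> * gauss_at x \<theta>) \<le> exp ((norm y)\<^sup>2 / 2) * gauss_at y \<theta>"
      by (simp add: E_def algebra_simps)
  qed
  also have "\<dots> = exp ((norm y)\<^sup>2 / 2) * J (gauss_at y)"
    by (simp add: J_cmult bb)
  finally show ?thesis
    by (simp add: E_def c_def s_def mult_ac)
qed

section \<open>Optimality conditions\<close>

text \<open>The angle at the projection between \<theta> and any point of the convex set is not
  acute, so the side from \<open>x\<close> to \<theta> is the longest of the triangle.\<close>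

lemma closest_point_norm_less:
  fixes x \<theta> :: "'a::euclidean_space"
  assumes "convex S" "closed S" "x \<in> S" "\<theta> \<notin> S"
  shows "norm (x - closest_point S \<theta>) < norm (x - \<theta>)"
proof -
  define c where "c = closest_point S \<theta>"
  have "c \<in> S"
    unfolding c_def using assms by (intro closest_point_in_set) auto
  then have "0 < (c - \<theta>) \<bullet> (c - \<theta>)"
    using assms(4) by auto
  moreover have "(\<theta> - c) \<bullet> (x - c) \<le> 0"
    unfolding c_def by (rule closest_point_dot[OF assms(1-3)])
  ultimately have "(x - c) \<bullet> (x - c) < (x - \<theta>) \<bullet> (x - \<theta>)"
    by (simp add: algebra_simps inner_commute)
  then show ?thesis
    by (simp add: c_def norm_lt)
qed

text \<open>On the segment from a maximizer \<open>p\<close> to \<open>q\<close>, the derivative of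
  the objective at \<open>p\<close> is \<open>(\<Sum>i. q $ i / p $ i)\<close> minus the number of
  coordinates, and it cannot be positive.\<close>

lemma sum_ln_maximizer:
  fixes H :: "(real ^ 'n) set"
  assumes "compact H" "convex H" "H \<noteq> {}" and pos: "\<And>q i. q \<in> H \<Longrightarrow> 0 < q $ i"
  obtains p where "p \<in> H" "\<And>q. q \<in> H \<Longrightarrow> (\<Sum>i\<in>UNIV. q $ i / p $ i) \<le> real CARD('n)"
proof -
  have "continuous_on H (\<lambda>q. \<Sum>i\<in>UNIV. ln (q $ i))"
    using pos by (intro continuous_intros) (metis less_irrefl)
  then obtain p where p: "p \<in> H" and max: "\<And>q. q \<in> H \<Longrightarrow> (\<Sum>i\<in>UNIV. ln (q $ i)) \<le> (\<Sum>i\<in>UNIV. ln (p $ i))"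
    using continuous_attains_sup[OF assms(1,3)] by blast
  show thesis
  proof
    fix q assume q: "q \<in> H"
    define f where "f = (\<lambda>t. \<Sum>i\<in>UNIV. ln (p $ i + t * (q $ i - p $ i)))"
    define D where "D = (\<Sum>i\<in>UNIV. (q $ i - p $ i) / p $ i)"
    have "DERIV f 0 :> D"
      unfolding f_def D_def using pos[OF p]
      by (auto intro!: derivative_eq_intros sum.cong)
    have "D \<le> 0"
    proof (rule ccontr)
      assume "\<not> D \<le> 0"
      then obtain d where d: "d > 0" "\<And>h. 0 < h \<Longrightarrow> h < d \<Longrightarrow> f 0 < f (0 + h)"
        using DERIV_pos_inc_right[OF \<open>DERIV f 0 :> D\<close>] by auto
      \<comment> \<open>Small enough for the strict increase, and at most \<open>1\<close> to stay
        on the segment.\<close>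
      define t where "t = min (d / 2) 1"
      have t: "0 < t" "t < d" "t \<le> 1"
        using d(1) by (auto simp: t_def min_def)
      have "(1 - t) *\<^sub>R p + t *\<^sub>R q \<in> H"
        using convexD_alt[OF assms(2) p q, of t] t by simp
      from max[OF this] have "f t \<le> f 0"
        by (simp add: f_def algebra_simps)
      then show False using d(2)[OF t(1,2)] by simp
    qed
    moreover have "D = (\<Sum>i\<in>UNIV. q $ i / p $ i) - real CARD('n)"
      using pos[OF p] by (simp add: D_def diff_divide_distrib sum_subtractf less_imp_neq[symmetric])
    ultimately show "(\<Sum>i\<in>UNIV. q $ i / p $ i) \<le> real CARD('n)"
      by simp
  qed (rule p)
qed

text \<open>The coefficients of a convex combination of likelihood vectors serve as the weights of a
  finitely supported mixing measure.\<close>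

lemma mixture_density_convex_hull:
  fixes X :: "real ^ 'd ^ 'n"
  assumes "q \<in> convex hull ((\<lambda>\<theta>. \<chi> i. gauss_at (X $ i) \<theta>) ` C)"
  obtains \<mu> where "\<mu> \<in> borel_prob_measures" "\<And>i. mixture_density \<mu> (X $ i) = q $ i"
proof -
  let ?v = "\<lambda>\<theta>. \<chi> i. gauss_at (X $ i) \<theta>"
  obtain S u where S: "finite S" "S \<subseteq> ?v ` C" and u: "\<And>y. y \<in> S \<Longrightarrow> 0 \<le> u y"
    and u1: "sum u S = 1" and q: "(\<Sum>y\<in>S. u y *\<^sub>R y) = q"
    using assms by (auto simp: convex_hull_explicit)
  obtain g where g: "\<And>y. y \<in> S \<Longrightarrow> ?v (g y) = y"
    using bchoice[of S "\<lambda>y \<theta>. ?v \<theta> = y"] S(2) by blast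
  define w where "w = (\<lambda>y. if y \<in> S then u y else 0)"
  have w0: "0 \<le> w y" for y
    using u by (simp add: w_def)
  have "(\<integral>\<^sup>+y. ennreal (w y) \<partial>count_space UNIV) = (\<Sum>y\<in>S. ennreal (w y))"
    by (rule nn_integral_count_space'[OF S(1)]) (auto simp: w_def)
  also have "\<dots> = ennreal (\<Sum>y\<in>S. w y)"
    using w0 by (intro sum_ennreal) auto
  also have "(\<Sum>y\<in>S. w y) = 1"
    by (simp add: w_def u1)
  finally have w1: "(\<integral>\<^sup>+y. ennreal (w y) \<partial>count_space UNIV) = 1"
    by simp
  define P where "P = embed_pmf w"
  have pmf: "pmf P y = w y" for y
    unfolding P_def by (rule pmf_embed_pmf[OF w0 w1])
  \<comment> \<open>The weights live on likelihood vectors and are carried to parameters by the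
    chosen preimages \<open>g\<close>, so different parameters may share a likelihood
    vector.\<close>
  define \<mu> where "\<mu> = distr (measure_pmf P) borel g"
  show thesis
  proof
    show "\<mu> \<in> borel_prob_measures"
      unfolding borel_prob_measures_def \<mu>_def
      by (auto intro!: measure_pmf.prob_space_distr)
    fix i
    have "mixture_density \<mu> (X $ i) = (\<integral>y. gauss_at (X $ i) (g y) \<partial>measure_pmf P)"
      unfolding mixture_density_def \<mu>_def
      using bounded_borel_gauss by (intro integral_distr) (auto simp: bounded_borel_def)
    also have "\<dots> = (\<Sum>y\<in>S. gauss_at (X $ i) (g y) * pmf P y)"
      by (rule integral_measure_pmf_real[OF S(1)]) (auto simp: set_pmf_iff pmf w_def split: if_splits)
    also have "\<dots> = (\<Sum>y\<in>S. u y * y $ i)"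
    proof (rule sum.cong)
      fix y assume y: "y \<in> S"
      have "gauss_at (X $ i) (g y) = ?v (g y) $ i" by simp
      also have "\<dots> = y $ i" unfolding g[OF y] ..
      finally show "gauss_at (X $ i) (g y) * pmf P y = u y * y $ i"
        using y by (simp add: pmf w_def)
    qed simp
    also have "\<dots> = q $ i"
      unfolding q[symmetric] by simp
    finally show "mixture_density \<mu> (X $ i) = q $ i" .
  qed
qed

text \<open>The first-order condition for the concave problem of maximizing \<open>\<Sum>i. ln (q\<^sub>i)\<close> over
  attainable likelihood vectors \<open>q\<close>.  Moving \<open>\<theta>\<close> to its projection onto a ball containing the
  data increases every likelihood, which reduces the problem to a compact one.\<close>

lemma npmle_certificate:
  fixes X :: "real ^ 'd ^ 'n"
  obtains \<mu> p R where "\<mu> \<in> borel_prob_measures" "\<And>i. mixture_density \<mu> (X $ i) = p $ i"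
    "\<And>\<theta>. (\<Sum>i\<in>UNIV. gauss_at (X $ i) \<theta> / p $ i) \<le> real CARD('n)"
    "\<And>\<theta>. R < norm \<theta> \<Longrightarrow> (\<Sum>i\<in>UNIV. gauss_at (X $ i) \<theta> / p $ i) < real CARD('n)"
proof -
  \<comment> \<open>The norm of the whole dataset bounds that of every observation, so the ball
    contains the data.\<close>
  define R where "R = norm X"
  define v where "v = (\<lambda>\<theta>. \<chi> i. gauss_at (X $ i) \<theta>)"
  define H where "H = convex hull (v ` cball 0 R)"
  have X: "X $ i \<in> cball 0 R" for i
    using Finite_Cartesian_Product.norm_nth_le[of X i] by (simp add: R_def)
  then have ne: "cball 0 R \<noteq> ({} :: (real ^ 'd) set)"
    by blast
  have "continuous_on (cball 0 R) v"
    unfolding v_def gauss_density_def by (auto intro!: continuous_intros)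
  then have "compact H"
    unfolding H_def by (intro compact_convex_hull compact_continuous_image) auto
  moreover have "convex H" "H \<noteq> {}"
    using ne by (simp_all add: H_def)
  moreover have "0 < q $ i" if "q \<in> H" for q i
  proof -
    \<comment> \<open>Positivity of the likelihoods passes to their hull through a half-space, which
      keeps the logarithms defined there.\<close>
    have "convex {q :: real ^ 'n. 0 < q $ i}"
      using convex_halfspace_gt[of 0 "axis i (1::real)"] by (simp only: inner_axis') simp
    then have "H \<subseteq> {q. 0 < q $ i}"
      unfolding H_def by (intro hull_minimal) (auto simp: v_def gauss_density_pos)
    then show ?thesis using that by blast
  qed
  ultimately obtain p where p: "p \<in> H" and le: "\<And>q. q \<in> H \<Longrightarrow> (\<Sum>i\<in>UNIV. q $ i / p $ i) \<le> real CARD('n)"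
    using sum_ln_maximizer by blast
  obtain \<mu> where \<mu>: "\<mu> \<in> borel_prob_measures" "\<And>i. mixture_density \<mu> (X $ i) = p $ i"
    using mixture_density_convex_hull p unfolding H_def v_def by blast
  have in_ball: "(\<Sum>i\<in>UNIV. gauss_at (X $ i) \<theta> / p $ i) \<le> real CARD('n)" if "\<theta> \<in> cball 0 R" for \<theta>
  proof -
    have "v \<theta> \<in> H"
      unfolding H_def using that by (intro hull_inc imageI)
    from le[OF this] show ?thesis by (simp add: v_def)
  qed
  have outside: "(\<Sum>i\<in>UNIV. gauss_at (X $ i) \<theta> / p $ i) < real CARD('n)" if "R < norm \<theta>" for \<theta>
  proof -
    define c where "c = closest_point (cball 0 R) \<theta>"
    have "norm (X $ i - c) < norm (X $ i - \<theta>)" for i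
      unfolding c_def using X that by (intro closest_point_norm_less) auto
    then have "gauss_at (X $ i) \<theta> < gauss_at (X $ i) c" for i
      by (rule gauss_density_less)
    then have "(\<Sum>i\<in>UNIV. gauss_at (X $ i) \<theta> / p $ i) < (\<Sum>i\<in>UNIV. gauss_at (X $ i) c / p $ i)"
      using mixture_density_pos[OF \<mu>(1)] by (intro sum_strict_mono divide_strict_right_mono) (auto simp: \<mu>(2)[symmetric])
    also have "\<dots> \<le> real CARD('n)"
      unfolding c_def using ne by (intro in_ball closest_point_in_set) auto
    finally show ?thesis .
  qed
  have "(\<Sum>i\<in>UNIV. gauss_at (X $ i) \<theta> / p $ i) \<le> real CARD('n)" for \<theta>
    using in_ball[of \<theta>] outside[of \<theta>] by (cases "R < norm \<theta>") auto
  then show thesis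
    using \<mu> outside by (intro that[of \<mu> p R])
qed

text \<open>Sum \<open>ln r \<le> r - 1\<close> over the ratios \<open>r = q i / p i\<close>.
  Equality of the sums forces every ratio to be \<open>1\<close>, so the optimal likelihood vector
  is unique.\<close>

lemma sum_ln_le_if_sum_divide_le:
  fixes p q :: "'n::finite \<Rightarrow> real"
  assumes "\<And>i. 0 < p i" "\<And>i. 0 < q i" and le: "(\<Sum>i\<in>UNIV. q i / p i) \<le> real CARD('n)"
  shows "(\<Sum>i\<in>UNIV. ln (q i)) \<le> (\<Sum>i\<in>UNIV. ln (p i))"
    and "(\<Sum>i\<in>UNIV. ln (q i)) = (\<Sum>i\<in>UNIV. ln (p i)) \<Longrightarrow> q i = p i"
proof -
  define r where "r = (\<lambda>i. q i / p i)"
  have r: "0 < r i" for i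
    using assms by (simp add: r_def)
  have gap: "0 \<le> r i - 1 - ln (r i)" for i
    using ln_le_minus_one[OF r] by (simp add: algebra_simps)
  have eq: "(\<Sum>i\<in>UNIV. r i - 1 - ln (r i))
      = (\<Sum>i\<in>UNIV. r i) - real CARD('n) - (\<Sum>i\<in>UNIV. ln (q i)) + (\<Sum>i\<in>UNIV. ln (p i))"
    using assms(1,2)[THEN less_imp_neq] assms(1,2)
    by (simp add: r_def ln_div sum_subtractf)
  have "0 \<le> (\<Sum>i\<in>UNIV. r i - 1 - ln (r i))"
    by (intro sum_nonneg gap)
  then show "(\<Sum>i\<in>UNIV. ln (q i)) \<le> (\<Sum>i\<in>UNIV. ln (p i))"
    using le eq by (simp add: r_def)
  assume "(\<Sum>i\<in>UNIV. ln (q i)) = (\<Sum>i\<in>UNIV. ln (p i))"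
  then have "(\<Sum>i\<in>UNIV. r i - 1 - ln (r i)) = 0"
    using le eq \<open>0 \<le> (\<Sum>i\<in>UNIV. r i - 1 - ln (r i))\<close> by (simp add: r_def)
  then have "r i - 1 - ln (r i) = 0"
    using gap by (subst (asm) sum_nonneg_eq_0_iff) auto
  then have "r i = 1"
    using ln_eq_minus_one[OF r, of i] by simp
  then show "q i = p i"
    using assms(1)[of i] by (simp add: r_def)
qed

text \<open>The certificate is pointwise in \<theta>, so monotonicity and linearity of
  \<open>J\<close> suffice, whether or not \<open>J\<close> is given as an integral.\<close>

lemma mean_sum_divide_le:
  fixes X :: "real ^ 'd ^ 'n" and p :: "real ^ 'n"
  assumes "mean_functional J" and le: "\<And>\<theta>. (\<Sum>i\<in>UNIV. gauss_at (X $ i) \<theta> / p $ i) \<le> c"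
  shows "(\<Sum>i\<in>UNIV. J (gauss_at (X $ i)) / p $ i) \<le> c"
proof -
  interpret mean_functional J by fact
  note bb = bounded_borel_sum bounded_borel_divide bounded_borel_gauss bounded_borel_const
  have "J (\<lambda>\<theta>. gauss_at (X $ i) \<theta> / p $ i) = J (gauss_at (X $ i)) / p $ i" for i
    using J_cmult[OF bounded_borel_gauss, of "1 / p $ i"] by simp
  then have "(\<Sum>i\<in>UNIV. J (gauss_at (X $ i)) / p $ i) = J (\<lambda>\<theta>. \<Sum>i\<in>UNIV. gauss_at (X $ i) \<theta> / p $ i)"
    by (simp add: J_sum bb)
  also have "\<dots> \<le> J (\<lambda>_. c)"
    by (intro J_mono bb le)
  finally show ?thesis by (simp add: J_const)
qed

section \<open>The maximal likelihood, the convex potential and its subgradients\<close>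

definition max_log_likelihood :: "real ^ 'd ^ 'n \<Rightarrow> real" where
  "max_log_likelihood X = (SUP \<nu>\<in>borel_prob_measures. log_likelihood X \<nu>)"

text \<open>The certificate bounds the likelihood ratios of every competitor, hence its
  log-likelihood, so the certified measure is an NPMLE. The pointwise bounds are exported because
  they constrain the support of all other maximizers.\<close>

lemma npmle_optimality:
  fixes X :: "real ^ 'd ^ 'n"
  obtains \<mu> p R where "is_npmle X \<mu>" "\<And>i. 0 < p $ i"
    "max_log_likelihood X = (\<Sum>i\<in>UNIV. ln (p $ i))"
    "\<And>\<theta>. (\<Sum>i\<in>UNIV. gauss_at (X $ i) \<theta> / p $ i) \<le> real CARD('n)"
    "\<And>\<theta>. R < norm \<theta> \<Longrightarrow> (\<Sum>i\<in>UNIV. gauss_at (X $ i) \<theta> / p $ i) < real CARD('n)"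
proof -
  obtain \<mu> p R where \<mu>: "\<mu> \<in> borel_prob_measures" and p: "\<And>i. mixture_density \<mu> (X $ i) = p $ i"
    and le: "\<And>\<theta>. (\<Sum>i\<in>UNIV. gauss_at (X $ i) \<theta> / p $ i) \<le> real CARD('n)"
    and less: "\<And>\<theta>. R < norm \<theta> \<Longrightarrow> (\<Sum>i\<in>UNIV. gauss_at (X $ i) \<theta> / p $ i) < real CARD('n)"
    using npmle_certificate[of X] by blast
  have pos: "0 < p $ i" for i
    using mixture_density_pos[OF \<mu>, of "X $ i"] by (simp add: p)
  have val: "log_likelihood X \<mu> = (\<Sum>i\<in>UNIV. ln (p $ i))"
    by (simp add: log_likelihood_def p)
  have "log_likelihood X \<nu> \<le> (\<Sum>i\<in>UNIV. ln (p $ i))" if \<nu>: "\<nu> \<in> borel_prob_measures" for \<nu>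
    unfolding log_likelihood_def
    using mean_sum_divide_le[OF mean_functional_integral[OF \<nu>] le]
    by (intro sum_ln_le_if_sum_divide_le(1) pos mixture_density_pos[OF \<nu>])
       (simp add: mixture_density_def)
  then have "max_log_likelihood X = (\<Sum>i\<in>UNIV. ln (p $ i))"
    unfolding max_log_likelihood_def
    by (intro cSup_eq_maximum) (use \<mu> val in \<open>auto intro: rev_image_eqI\<close>)
  moreover from this have "is_npmle X \<mu>"
    using \<mu> val by (simp add: is_npmle_def max_log_likelihood_def)
  ultimately show thesis
    using that pos le less by blast
qed

text \<open>Lets reweighted averages compete in the maximization although they are given only as
  functionals.\<close>

lemma mean_log_le:
  fixes X :: "real ^ 'd ^ 'n"
  assumes "mean_functional J" "\<And>i. 0 < J (gauss_at (X $ i))"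
  shows "(\<Sum>i\<in>UNIV. ln (J (gauss_at (X $ i)))) \<le> max_log_likelihood X"
proof -
  obtain p where "\<And>i. 0 < p $ i" "max_log_likelihood X = (\<Sum>i\<in>UNIV. ln (p $ i))"
    "\<And>\<theta>. (\<Sum>i\<in>UNIV. gauss_at (X $ i) \<theta> / p $ i) \<le> real CARD('n)"
    by (rule npmle_optimality[of X]) blast
  then show ?thesis
    using assms(2) mean_sum_divide_le[OF assms(1), of X p]
    by (simp add: sum_ln_le_if_sum_divide_le(1))
qed

definition potential :: "real ^ 'd ^ 'n \<Rightarrow> real" where
  "potential X = max_log_likelihood X + (norm X)\<^sup>2 / 2"

text \<open>With \<open>J\<close> held fixed, its log-likelihood plus the quadratic term lies below
  the potential at every \<open>Y\<close> and touches it at \<open>X\<close>. The tangent plane from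
  \<open>mean_gauss_tilt\<close>, whose slope is the vector of posterior means, therefore supports
  the potential as well.\<close>

lemma subgradient_potential:
  fixes X :: "real ^ 'd ^ 'n"
  assumes J: "mean_functional J" and pos: "\<And>i. 0 < J (gauss_at (X $ i))"
    and max: "(\<Sum>i\<in>UNIV. ln (J (gauss_at (X $ i)))) = max_log_likelihood X"
  shows "subgradient potential X
    (\<chi> i. \<chi> a. J (\<lambda>\<theta>. \<theta> $ a * gauss_at (X $ i) \<theta>) / J (gauss_at (X $ i)))"
    (is "subgradient _ _ ?m")
  unfolding subgradient_def
proof
  interpret mean_functional J by fact
  fix Y :: "real ^ 'd ^ 'n"
  define c where "c = (\<lambda>i. J (\<lambda>\<theta>. ((Y $ i - X $ i) \<bullet> \<theta>) * gauss_at (X $ i) \<theta>) / J (gauss_at (X $ i)))"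
  have lin: "J (\<lambda>\<theta>. (h \<bullet> \<theta>) * gauss_at x \<theta>) = (\<Sum>a\<in>UNIV. h $ a * J (\<lambda>\<theta>. \<theta> $ a * gauss_at x \<theta>))"
    for h x :: "real ^ 'd"
  proof -
    have "(\<lambda>\<theta>. (h \<bullet> \<theta>) * gauss_at x \<theta>) = (\<lambda>\<theta>. \<Sum>a\<in>UNIV. h $ a * (\<theta> $ a * gauss_at x \<theta>))"
      by (simp add: inner_vec_def sum_distrib_right mult.assoc)
    then show ?thesis
      by (simp add: J_sum J_cmult bounded_borel_cmult bounded_borel_nth_gauss)
  qed
  have "?m $ i \<bullet> (Y $ i - X $ i) = c i" for i
    unfolding c_def lin by (simp add: inner_vec_def sum_divide_distrib mult.commute)
  then have m: "?m \<bullet> (Y - X) = (\<Sum>i\<in>UNIV. c i)"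
    by (simp add: inner_vec_def[of ?m])
  have norm: "(norm Z)\<^sup>2 / 2 = (\<Sum>i\<in>UNIV. (norm (Z $ i))\<^sup>2 / 2)" for Z :: "real ^ 'd ^ 'n"
    by (simp add: power2_norm_eq_inner inner_vec_def[of Z] sum_divide_distrib)
  have tilt: "J (gauss_at (X $ i)) * exp ((norm (X $ i))\<^sup>2 / 2) * exp (c i)
      \<le> J (gauss_at (Y $ i)) * exp ((norm (Y $ i))\<^sup>2 / 2)" for i
    unfolding c_def by (rule mean_gauss_tilt[OF J pos])
  \<comment> \<open>An abstract \<open>J\<close> need not be strictly positive on positive
    functions, so positivity is carried over from \<open>X\<close> by the tilt inequality.\<close>
  have posY: "0 < J (gauss_at (Y $ i))" for i
  proof -
    have "0 < J (gauss_at (X $ i)) * exp ((norm (X $ i))\<^sup>2 / 2) * exp (c i)"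
      using pos by simp
    then have "0 < J (gauss_at (Y $ i)) * exp ((norm (Y $ i))\<^sup>2 / 2)"
      using tilt by (rule less_le_trans)
    then show ?thesis by (simp add: zero_less_mult_iff)
  qed
  have "ln (J (gauss_at (X $ i))) + (norm (X $ i))\<^sup>2 / 2 + c i
      \<le> ln (J (gauss_at (Y $ i))) + (norm (Y $ i))\<^sup>2 / 2" for i
  proof -
    have "ln (J (gauss_at (X $ i)) * exp ((norm (X $ i))\<^sup>2 / 2) * exp (c i))
        \<le> ln (J (gauss_at (Y $ i)) * exp ((norm (Y $ i))\<^sup>2 / 2))"
      using pos by (intro ln_mono tilt) simp
    then show ?thesis
      using pos[of i] posY[of i] by (simp add: ln_mult)
  qed
  then have "(\<Sum>i\<in>UNIV. ln (J (gauss_at (X $ i))) + (norm (X $ i))\<^sup>2 / 2 + c i)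
      \<le> (\<Sum>i\<in>UNIV. ln (J (gauss_at (Y $ i))) + (norm (Y $ i))\<^sup>2 / 2)"
    by (intro sum_mono)
  also have "\<dots> \<le> potential Y"
    using mean_log_le[of J Y, OF J posY] by (simp add: potential_def norm sum.distrib)
  finally show "potential X + ?m \<bullet> (Y - X) \<le> potential Y"
    by (simp add: potential_def norm sum.distrib m max)
qed

lemma npmle_sum_ln:
  assumes "is_npmle X \<mu>"
  shows "(\<Sum>i\<in>UNIV. ln (integral\<^sup>L \<mu> (gauss_at (X $ i)))) = max_log_likelihood X"
  using assms by (simp add: is_npmle_def max_log_likelihood_def log_likelihood_def mixture_density_def)

lemma integral_gauss_pos:
  "\<mu> \<in> borel_prob_measures \<Longrightarrow> 0 < integral\<^sup>L \<mu> (gauss_at x)"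
  using mixture_density_pos[of \<mu> x] by (simp add: mixture_density_def)

lemma ex_subgradient_potential: "\<exists>m. subgradient potential X m"
proof -
  obtain \<mu> where \<mu>: "is_npmle X \<mu>"
    by (rule npmle_optimality[of X]) blast
  then have "\<mu> \<in> borel_prob_measures"
    by (simp add: is_npmle_def)
  then show ?thesis
    using subgradient_potential[of "integral\<^sup>L \<mu>" X] npmle_sum_ln[OF \<mu>]
      mean_functional_integral integral_gauss_pos by blast
qed

section \<open>Uniqueness\<close>

text \<open>The indicator of a closed set is a limit of bounded continuous functions of the distance
  to it, and the closed sets are an intersection-stable generator of the Borel sets.\<close>

lemma measure_eqI_continuous:
  fixes \<mu> \<nu> :: "'a::metric_space measure"
  assumes "prob_space \<mu>" "prob_space \<nu>" and sets: "sets \<mu> = sets borel" "sets \<nu> = sets borel"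
    and eq: "\<And>g :: 'a \<Rightarrow> real. continuous_on UNIV g \<Longrightarrow> (\<And>x. \<bar>g x\<bar> \<le> 1) \<Longrightarrow> integral\<^sup>L \<mu> g = integral\<^sup>L \<nu> g"
  shows "\<mu> = \<nu>"
proof -
  interpret M: prob_space \<mu> by fact
  interpret N: prob_space \<nu> by fact
  have "measure \<mu> C = measure \<nu> C" if C: "closed C" for C
  \<comment> \<open>\<open>infdist\<close> to the empty set is \<open>0\<close> by convention, so
    the approximation below would tend to \<open>1\<close> there.\<close>
  proof (cases "C = {}")
    case False
    define g where "g = (\<lambda>k::nat. \<lambda>x. max 0 (1 - real k * infdist x C))"
    have cont: "continuous_on UNIV (g k)" for k
      unfolding g_def by (intro continuous_intros)
    have bound: "\<bar>g k x\<bar> \<le> 1" for k x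
      by (simp add: g_def infdist_nonneg)
    have conv: "(\<lambda>k. g k x) \<longlonglongrightarrow> indicator C x" for x
    proof (cases "x \<in> C")
      case True
      then show ?thesis by (simp add: g_def)
    next
      case out: False
      then have d: "0 < infdist x C"
        using C False by (metis in_closed_iff_infdist_zero infdist_nonneg order_le_less)
      obtain K where "1 < real K * infdist x C"
        using reals_Archimedean3[OF d] by blast
      moreover have "real K * infdist x C \<le> real k * infdist x C" if "K \<le> k" for k
        using that d by (intro mult_right_mono) auto
      ultimately have "g k x = 0" if "K \<le> k" for k
        using that unfolding g_def by (intro max_absorb1) (smt (verit))
      then have "eventually (\<lambda>k. g k x = 0) sequentially"
        by (auto simp: eventually_sequentially)
      then show ?thesis
        using out by (simp add: tendsto_eventually)
    qed
    have lim: "(\<lambda>k. integral\<^sup>L \<rho> (g k)) \<longlonglongrightarrow> measure \<rho> C"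
      if \<rho>: "prob_space \<rho>" "sets \<rho> = sets borel" for \<rho>
    proof -
      interpret prob_space \<rho> by fact
      have [measurable_cong]: "sets \<rho> = sets borel" by fact
      have [measurable]: "g k \<in> borel_measurable borel" for k
        by (rule borel_measurable_continuous_onI[OF cont])
      have [measurable]: "C \<in> sets borel" using C by simp
      have "(\<lambda>k. integral\<^sup>L \<rho> (g k)) \<longlonglongrightarrow> integral\<^sup>L \<rho> (indicator C :: 'a \<Rightarrow> real)"
        by (rule integral_dominated_convergence[where w = "\<lambda>_. 1"]) (use conv bound in auto)
      then show ?thesis
        using \<open>C \<in> sets borel\<close> \<rho>(2) by (simp add: integral_indicator)
    qed
    have "(\<lambda>k. integral\<^sup>L \<mu> (g k)) \<longlonglongrightarrow> measure \<nu> C"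
      using lim[of \<nu>] assms eq[OF cont bound] by simp
    then show ?thesis
      using lim[of \<mu>] assms LIMSEQ_unique by blast
  qed simp
  then have closed_eq: "emeasure \<mu> C = emeasure \<nu> C" if "closed C" for C
    using that by (simp add: M.emeasure_eq_measure N.emeasure_eq_measure)
  have borel: "sets (borel :: 'a measure) = sigma_sets UNIV (Collect closed)"
    unfolding borel_eq_closed by (rule sets_measure_of) simp
  show ?thesis
  proof (rule measure_eqI_generator_eq[where E = "Collect closed" and \<Omega> = UNIV and A = "\<lambda>_. UNIV"])
    show "Int_stable (Collect closed :: 'a set set)"
      by (auto simp: Int_stable_def)
  qed (use closed_eq borel sets in auto)
qed

text \<open>\<open>p\<close> and \<open>R\<close> come from \<open>npmle_optimality\<close> and are
  available for every \<open>X\<close>; only \<open>unique\<close> restricts \<open>X\<close> to a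
  set of full measure.\<close>

locale two_npmles =
  fixes X :: "real ^ 'd ^ 'n" and \<mu> \<nu> :: "(real ^ 'd) measure" and p :: "real ^ 'n" and R :: real
  assumes npmle: "is_npmle X \<mu>" "is_npmle X \<nu>"
    and p_pos: "\<And>i. 0 < p $ i"
    and p_max: "max_log_likelihood X = (\<Sum>i\<in>UNIV. ln (p $ i))"
    and le: "\<And>\<theta>. (\<Sum>i\<in>UNIV. gauss_at (X $ i) \<theta> / p $ i) \<le> real CARD('n)"
    and less: "\<And>\<theta>. R < norm \<theta> \<Longrightarrow> (\<Sum>i\<in>UNIV. gauss_at (X $ i) \<theta> / p $ i) < real CARD('n)"
    and unique: "\<And>m m'. subgradient potential X m \<Longrightarrow> subgradient potential X m' \<Longrightarrow> m = m'"
begin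

lemma bpm: "\<mu> \<in> borel_prob_measures" "\<nu> \<in> borel_prob_measures"
  using npmle by (simp_all add: is_npmle_def)

lemma prob: "prob_space \<mu>" "prob_space \<nu>" and sets: "sets \<mu> = sets borel" "sets \<nu> = sets borel"
  using bpm by (simp_all add: borel_prob_measures_def)

lemma int: "bounded_borel f \<Longrightarrow> integrable \<mu> f" "bounded_borel f \<Longrightarrow> integrable \<nu> f"
  by (simp_all add: integrable_bounded_borel prob sets)

text \<open>Equality in the log inequality fixes the likelihoods at \<open>p\<close>. The
  certificate function then has mean \<open>CARD('n)\<close> and never exceeds it, so it attains
  this value almost surely, which it cannot do outside the ball.\<close>

lemma fitted_and_support:
  assumes \<rho>: "\<rho> \<in> {\<mu>, \<nu>}"
  shows "integral\<^sup>L \<rho> (gauss_at (X $ i)) = p $ i"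
    and "AE \<theta> in \<rho>. (\<Sum>i\<in>UNIV. gauss_at (X $ i) \<theta> / p $ i) = real CARD('n) \<and> norm \<theta> \<le> R"
proof -
  have npmle: "is_npmle X \<rho>" and bpm: "\<rho> \<in> borel_prob_measures"
    using \<rho> npmle bpm by auto
  have int: "integrable \<rho> f" if "bounded_borel f" for f
    using \<rho> int that by auto
  interpret prob_space \<rho> using bpm by (simp add: borel_prob_measures_def)
  have fit: "integral\<^sup>L \<rho> (gauss_at (X $ i)) = p $ i" for i
  proof (rule sum_ln_le_if_sum_divide_le(2))
    show "(\<Sum>i\<in>UNIV. integral\<^sup>L \<rho> (gauss_at (X $ i)) / p $ i) \<le> real CARD('n)"
      by (rule mean_sum_divide_le[OF mean_functional_integral[OF bpm] le])
    show "(\<Sum>i\<in>UNIV. ln (integral\<^sup>L \<rho> (gauss_at (X $ i)))) = (\<Sum>i\<in>UNIV. ln (p $ i))"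
      using npmle_sum_ln[OF npmle] p_max by simp
  qed (auto simp: p_pos integral_gauss_pos[OF bpm])
  show "integral\<^sup>L \<rho> (gauss_at (X $ i)) = p $ i"
    by (rule fit)
  define D where "D = (\<lambda>\<theta>. \<Sum>i\<in>UNIV. gauss_at (X $ i) \<theta> / p $ i)"
  have D: "bounded_borel D"
    unfolding D_def by (intro bounded_borel_sum bounded_borel_divide bounded_borel_gauss)
  have "integral\<^sup>L \<rho> D = (\<Sum>i\<in>UNIV. p $ i / p $ i)"
    unfolding D_def
    by (subst Bochner_Integration.integral_sum) (simp_all add: fit int bounded_borel_divide bounded_borel_gauss)
  also have "\<dots> = real CARD('n)"
    using p_pos[THEN less_imp_neq] by simp
  finally have "(\<integral>\<theta>. real CARD('n) - D \<theta> \<partial>\<rho>) = 0"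
    by (simp add: int D prob_space)
  then have "AE \<theta> in \<rho>. real CARD('n) - D \<theta> = 0"
    using le by (subst (asm) integral_nonneg_eq_0_iff_AE) (simp_all add: int D, simp add: D_def)
  then show "AE \<theta> in \<rho>. (\<Sum>i\<in>UNIV. gauss_at (X $ i) \<theta> / p $ i) = real CARD('n) \<and> norm \<theta> \<le> R"
  proof eventually_elim
    case (elim \<theta>)
    then show ?case
      using less[of \<theta>] by (auto simp: D_def not_less[symmetric])
  qed
qed

text \<open>Adding the signed measure \<open>f d\<mu> - f d\<nu>\<close> to the average of the two
  estimators changes no fitted likelihood.\<close>

definition balanced :: "(real ^ 'd \<Rightarrow> real) \<Rightarrow> bool" where
  "balanced f \<longleftrightarrow> bounded_borel f \<and>
    (\<forall>i. (\<integral>\<theta>. f \<theta> * gauss_at (X $ i) \<theta> \<partial>\<mu>) = (\<integral>\<theta>. f \<theta> * gauss_at (X $ i) \<theta> \<partial>\<nu>))"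

lemma bounded_borel_balanced: "balanced f \<Longrightarrow> bounded_borel f"
  by (simp add: balanced_def)

lemma balanced_const: "balanced (\<lambda>_. c)"
  using fitted_and_support(1) by (simp add: balanced_def bounded_borel_const)

lemma balanced_add: "balanced f \<Longrightarrow> balanced g \<Longrightarrow> balanced (\<lambda>\<theta>. f \<theta> + g \<theta>)"
  by (simp add: balanced_def bounded_borel_add distrib_right int bounded_borel_mult bounded_borel_gauss)

lemma balanced_cmult: "balanced f \<Longrightarrow> balanced (\<lambda>\<theta>. c * f \<theta>)"
  by (simp add: balanced_def bounded_borel_cmult mult.assoc)

lemma balanced_sum:
  "(\<And>a. a \<in> A \<Longrightarrow> balanced (f a)) \<Longrightarrow> balanced (\<lambda>\<theta>. \<Sum>a\<in>A. f a \<theta>)"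
  by (induction A rule: infinite_finite_induct) (auto intro: balanced_const balanced_add)

text \<open>\<open>1\<close> is almost surely a combination of the likelihoods, for both estimators.\<close>

lemma balanced_integral_eq:
  assumes f: "balanced f"
  shows "integral\<^sup>L \<mu> f = integral\<^sup>L \<nu> f"
proof -
  note bb = bounded_borel_balanced[OF f] bounded_borel_mult bounded_borel_divide bounded_borel_gauss
  have "integral\<^sup>L \<rho> f = (\<Sum>i\<in>UNIV. (\<integral>\<theta>. f \<theta> * gauss_at (X $ i) \<theta> \<partial>\<rho>) / p $ i) / real CARD('n)"
    if \<rho>: "\<rho> \<in> {\<mu>, \<nu>}" for \<rho>
  proof -
    have int: "integrable \<rho> g" "g \<in> borel_measurable \<rho>" if "bounded_borel g" for g
      using \<rho> int that by auto
    have "integral\<^sup>L \<rho> f = (\<integral>\<theta>. (\<Sum>i\<in>UNIV. f \<theta> * gauss_at (X $ i) \<theta> / p $ i) / real CARD('n) \<partial>\<rho>)"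
    proof (rule integral_cong_AE)
      show "AE \<theta> in \<rho>. f \<theta> = (\<Sum>i\<in>UNIV. f \<theta> * gauss_at (X $ i) \<theta> / p $ i) / real CARD('n)"
        using fitted_and_support(2)[OF \<rho>]
      proof eventually_elim
        case (elim \<theta>)
        have "(\<Sum>i\<in>UNIV. f \<theta> * gauss_at (X $ i) \<theta> / p $ i)
            = f \<theta> * (\<Sum>i\<in>UNIV. gauss_at (X $ i) \<theta> / p $ i)"
          by (simp add: sum_distrib_left)
        then show ?case using elim by simp
      qed
    qed (auto intro!: int bb bounded_borel_sum)
    also have "\<dots> = (\<Sum>i\<in>UNIV. (\<integral>\<theta>. f \<theta> * gauss_at (X $ i) \<theta> \<partial>\<rho>) / p $ i) / real CARD('n)"
      by (simp add: int bb)
    finally show ?thesis .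
  qed
  then show ?thesis
    using f by (simp add: balanced_def)
qed

text \<open>Reweighting the average of the two estimators by \<open>1/2 \<plusminus> f\<close> yields two further maximizers,
  whose posterior means must agree because the potential has only one subgradient at \<open>X\<close>.\<close>

lemma balanced_posterior_mean:
  assumes f: "balanced f"
  shows "(\<integral>\<theta>. f \<theta> * (\<theta> $ a * gauss_at (X $ i) \<theta>) \<partial>\<mu>)
    = (\<integral>\<theta>. f \<theta> * (\<theta> $ a * gauss_at (X $ i) \<theta>) \<partial>\<nu>)"
proof -
  define J where "J = (\<lambda>f (u :: real ^ 'd \<Rightarrow> real). (\<integral>\<theta>. (1 / 2 + f \<theta>) * u \<theta> \<partial>\<mu>) + (\<integral>\<theta>. (1 / 2 - f \<theta>) * u \<theta> \<partial>\<nu>))"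
  note bb = bounded_borel_mult bounded_borel_add bounded_borel_diff bounded_borel_const bounded_borel_gauss
    bounded_borel_nth_gauss
  have J_eq: "J f u = (integral\<^sup>L \<mu> u + integral\<^sup>L \<nu> u) / 2 + (\<integral>\<theta>. f \<theta> * u \<theta> \<partial>\<mu>) - (\<integral>\<theta>. f \<theta> * u \<theta> \<partial>\<nu>)"
    if "balanced f" "bounded_borel u" for f u
    using that bounded_borel_balanced[of f]
    by (simp add: J_def distrib_right left_diff_distrib add_divide_distrib int bb)
  have J_subgradient: "subgradient potential X (\<chi> i. \<chi> a. J f (\<lambda>\<theta>. \<theta> $ a * gauss_at (X $ i) \<theta>) / p $ i)"
    if f: "balanced f" and half: "\<And>\<theta>. \<bar>f \<theta>\<bar> \<le> 1 / 2" for f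
  proof -
    note bf = bounded_borel_balanced[OF f]
    have fit: "J f (gauss_at (X $ i)) = p $ i" for i
      using f fitted_and_support(1) by (simp add: J_eq bb balanced_def)
    have "mean_functional (J f)"
    proof
      show "J f (\<lambda>_. 1) = 1"
        using balanced_integral_eq[OF f] prob by (simp add: J_eq f bb prob_space.prob_space)
      show "J f (\<lambda>x. u x + v x) = J f u + J f v" if "bounded_borel u" "bounded_borel v" for u v
        using that bf by (simp add: J_eq f bb int distrib_left) (simp add: field_simps)
      show "J f (\<lambda>x. c * u x) = c * J f u" if "bounded_borel u" for c u
      proof -
        have "(\<lambda>\<theta>. f \<theta> * (c * u \<theta>)) = (\<lambda>\<theta>. c * (f \<theta> * u \<theta>))" by (simp add: mult_ac)
        then show ?thesis
          using that bf by (simp add: J_eq f bb algebra_simps)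
      qed
      have "0 \<le> 1 / 2 + f \<theta>" "0 \<le> 1 / 2 - f \<theta>" for \<theta>
        using half[of \<theta>] unfolding abs_le_iff by simp_all
      then show "0 \<le> J f u" if "bounded_borel u" "\<And>x. 0 \<le> u x" for u
        unfolding J_def using that(2)
        by (intro add_nonneg_nonneg[OF Bochner_Integration.integral_nonneg Bochner_Integration.integral_nonneg]
            mult_nonneg_nonneg)
    qed
    then have "subgradient potential X
        (\<chi> i. \<chi> a. J f (\<lambda>\<theta>. \<theta> $ a * gauss_at (X $ i) \<theta>) / J f (gauss_at (X $ i)))"
      by (rule subgradient_potential) (simp_all add: fit p_pos p_max)
    then show ?thesis by (simp add: fit)
  qed
  obtain B where B: "\<And>\<theta>. \<bar>f \<theta>\<bar> \<le> B"
    using bounded_borel_balanced[OF f] by (auto simp: bounded_borel_def)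
  have "0 \<le> B" using B[of 0] by linarith
  \<comment> \<open>Scaling by \<open>c\<close> keeps the weights
    \<open>1/2 \<plusminus> c f\<close> nonnegative; the summand \<open>1\<close> covers
    \<open>B = 0\<close>.\<close>
  define c where "c = 1 / (2 * (B + 1))"
  have c: "0 < c" using \<open>0 \<le> B\<close> by (simp add: c_def)
  have half: "\<bar>c * f \<theta>\<bar> \<le> 1 / 2" "\<bar>- c * f \<theta>\<bar> \<le> 1 / 2" for \<theta>
    using B[of \<theta>] \<open>0 \<le> B\<close> by (simp_all add: c_def abs_mult field_simps)
  let ?u = "\<lambda>\<theta>. \<theta> $ a * gauss_at (X $ i) \<theta>"
  \<comment> \<open>Between the two signs the unperturbed average cancels, which isolates the
    difference of the two integrals to be compared.\<close>
  have "(\<chi> i. \<chi> a. J (\<lambda>\<theta>. c * f \<theta>) (\<lambda>\<theta>. \<theta> $ a * gauss_at (X $ i) \<theta>) / p $ i)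
      = (\<chi> i. \<chi> a. J (\<lambda>\<theta>. - c * f \<theta>) (\<lambda>\<theta>. \<theta> $ a * gauss_at (X $ i) \<theta>) / p $ i)"
    by (intro unique J_subgradient balanced_cmult f half)
  from arg_cong[OF this, of "\<lambda>m. m $ i $ a"]
  have "J (\<lambda>\<theta>. c * f \<theta>) ?u = J (\<lambda>\<theta>. - c * f \<theta>) ?u"
    using p_pos[of i] by simp
  then have "c * (\<integral>\<theta>. f \<theta> * ?u \<theta> \<partial>\<mu>) = c * (\<integral>\<theta>. f \<theta> * ?u \<theta> \<partial>\<nu>)"
    using balanced_cmult[OF f, of c] balanced_cmult[OF f, of "- c"]
    by (simp add: J_eq bb mult.assoc)
  then show ?thesis using c by simp
qed

text \<open>Polynomials are unbounded, while \<open>balanced\<close> demands boundedness. The cutoff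
  is invisible to both estimators, whose mass lies in the ball.\<close>

definition truncated :: "(real ^ 'd \<Rightarrow> real) \<Rightarrow> (real ^ 'd \<Rightarrow> real) \<Rightarrow> real ^ 'd \<Rightarrow> real" where
  "truncated q f = (\<lambda>\<theta>. indicator (cball 0 R) \<theta> * q \<theta> * f \<theta>)"

lemma truncated_integral:
  assumes "bounded_borel (truncated q f)" "(\<lambda>\<theta>. q \<theta> * f \<theta> * g \<theta>) \<in> borel_measurable borel" "bounded_borel g"
    and \<rho>: "\<rho> \<in> {\<mu>, \<nu>}"
  shows "(\<integral>\<theta>. truncated q f \<theta> * g \<theta> \<partial>\<rho>) = (\<integral>\<theta>. q \<theta> * f \<theta> * g \<theta> \<partial>\<rho>)"
proof (rule integral_cong_AE)
  show "(\<lambda>\<theta>. truncated q f \<theta> * g \<theta>) \<in> borel_measurable \<rho>"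
    using \<rho> int[OF bounded_borel_mult[OF assms(1,3)]] by auto
  show "(\<lambda>\<theta>. q \<theta> * f \<theta> * g \<theta>) \<in> borel_measurable \<rho>"
    using \<rho> assms(2) sets measurable_cong_sets by blast
  show "AE \<theta> in \<rho>. truncated q f \<theta> * g \<theta> = q \<theta> * f \<theta> * g \<theta>"
    using fitted_and_support(2)[OF \<rho>] by eventually_elim (simp add: truncated_def)
qed

text \<open>Agreement of the perturbed posterior means, \<open>balanced_posterior_mean\<close>, is
  read here as closure of the balanced functions under multiplication by a coordinate.\<close>

lemma balanced_truncated_nth:
  assumes f: "balanced f"
  shows "balanced (truncated (\<lambda>\<theta>. \<theta> $ a) f)"
proof -
  have "bounded_borel (\<lambda>\<theta>. indicator (cball 0 R) \<theta> * \<theta> $ a)"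
  proof (rule bounded_borelI)
    show "\<bar>indicator (cball 0 R) \<theta> * \<theta> $ a\<bar> \<le> \<bar>R\<bar>" for \<theta> :: "real ^ 'd"
      using component_le_norm_cart[of \<theta> a] by (auto simp: indicator_def)
    show "(\<lambda>\<theta> :: real ^ 'd. indicator (cball 0 R) \<theta> * \<theta> $ a) \<in> borel_measurable borel"
      by (intro borel_measurable_times borel_measurable_indicator borel_closed closed_cball
          borel_measurable_continuous_onI continuous_intros)
  qed
  then have bb: "bounded_borel (truncated (\<lambda>\<theta>. \<theta> $ a) f)"
    unfolding truncated_def by (rule bounded_borel_mult[OF _ bounded_borel_balanced[OF f]])
  have [measurable]: "f \<in> borel_measurable borel"
    using bounded_borel_balanced[OF f] by (simp add: bounded_borel_def)
  have "(\<integral>\<theta>. truncated (\<lambda>\<theta>. \<theta> $ a) f \<theta> * gauss_at (X $ i) \<theta> \<partial>\<rho>)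
      = (\<integral>\<theta>. f \<theta> * (\<theta> $ a * gauss_at (X $ i) \<theta>) \<partial>\<rho>)" if "\<rho> \<in> {\<mu>, \<nu>}" for i \<rho>
  proof -
    have "(\<lambda>\<theta>. \<theta> $ a * f \<theta> * gauss_at (X $ i) \<theta>) \<in> borel_measurable borel"
      unfolding gauss_density_def by measurable
    from truncated_integral[OF bb this bounded_borel_gauss that] show ?thesis
      by (simp add: mult_ac)
  qed
  then show ?thesis
    using balanced_posterior_mean[OF f] bb by (simp add: balanced_def)
qed

lemma balanced_truncated_const:
  assumes f: "balanced f"
  shows "balanced (truncated (\<lambda>_. c) f)"
proof -
  have "bounded_borel (\<lambda>\<theta>. indicator (cball 0 R) \<theta> * c)"
    by (rule bounded_borelI[where B = "\<bar>c\<bar>"])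
       (auto intro!: borel_measurable_times borel_measurable_indicator borel_closed simp: abs_mult mult_left_le_one_le)
  then have bb: "bounded_borel (truncated (\<lambda>_. c) f)"
    unfolding truncated_def by (rule bounded_borel_mult[OF _ bounded_borel_balanced[OF f]])
  have [measurable]: "f \<in> borel_measurable borel"
    using bounded_borel_balanced[OF f] by (simp add: bounded_borel_def)
  have "(\<integral>\<theta>. truncated (\<lambda>_. c) f \<theta> * gauss_at (X $ i) \<theta> \<partial>\<rho>)
      = c * (\<integral>\<theta>. f \<theta> * gauss_at (X $ i) \<theta> \<partial>\<rho>)" if "\<rho> \<in> {\<mu>, \<nu>}" for i \<rho>
  proof -
    have "(\<lambda>\<theta>. c * f \<theta> * gauss_at (X $ i) \<theta>) \<in> borel_measurable borel"
      unfolding gauss_density_def by measurable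
    from truncated_integral[OF bb this bounded_borel_gauss that] show ?thesis
      by (simp add: mult.assoc)
  qed
  then show ?thesis
    using f bb by (simp add: balanced_def)
qed

text \<open>Polynomials are generated by coordinates and constants. Products are handled by applying
  the factors one after the other, hence the induction with \<open>f\<close> arbitrary.\<close>

lemma balanced_truncated_polynomial:
  assumes "real_polynomial_function q" "balanced f"
  shows "balanced (truncated q f)"
  using assms
proof (induction arbitrary: f)
  case (linear q)
  have expand: "q \<theta> = (\<Sum>a\<in>UNIV. q (axis a 1) * \<theta> $ a)" for \<theta>
  proof -
    have "q \<theta> = q (\<Sum>a\<in>UNIV. \<theta> $ a *\<^sub>R axis a 1)"
      by (simp add: basis_expansion flip: scalar_mult_eq_scaleR)
    then show ?thesis
      using bounded_linear.linear[OF linear(1)] by (simp add: linear_sum linear_cmul mult.commute)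
  qed
  have "truncated q f = (\<lambda>\<theta>. \<Sum>a\<in>UNIV. q (axis a 1) * truncated (\<lambda>\<theta>. \<theta> $ a) f \<theta>)"
    unfolding truncated_def
    by (rule ext, subst expand) (simp add: sum_distrib_left sum_distrib_right mult_ac)
  then show ?case
    by (simp add: balanced_sum balanced_cmult balanced_truncated_nth linear)
next
  case (const c)
  then show ?case by (rule balanced_truncated_const)
next
  case (add q r)
  have "truncated (\<lambda>x. q x + r x) f = (\<lambda>\<theta>. truncated q f \<theta> + truncated r f \<theta>)"
    by (simp add: truncated_def algebra_simps)
  then show ?case using add by (simp add: balanced_add)
next
  case (mult q r)
  \<comment> \<open>Cutting off twice is the same as once, since the indicator is
    idempotent.\<close>
  have "truncated (\<lambda>x. q x * r x) f = truncated q (truncated r f)"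
    by (auto simp: truncated_def fun_eq_iff indicator_def)
  then show ?case using mult by simp
qed

text \<open>On the ball a continuous function is uniformly close to a polynomial, by
  Stone-Weierstrass. The truncated polynomial is balanced, so both estimators give it the same
  integral.\<close>

lemma equal: "\<mu> = \<nu>"
proof (rule measure_eqI_continuous[OF prob sets])
  fix g :: "real ^ 'd \<Rightarrow> real"
  assume cont: "continuous_on UNIV g" and bound: "\<And>x. \<bar>g x\<bar> \<le> 1"
  have bg: "bounded_borel g"
    using borel_measurable_continuous_onI[OF cont] bound by (rule bounded_borelI)
  have "\<bar>integral\<^sup>L \<mu> g - integral\<^sup>L \<nu> g\<bar> \<le> e" if "0 < e" for e
  proof -
    have "0 < e / 2" using that by simp
    then obtain q where q: "real_polynomial_function q" "\<And>x. x \<in> cball 0 R \<Longrightarrow> \<bar>g x - q x\<bar> < e / 2"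
      using Stone_Weierstrass_real_polynomial_function[OF compact_cball continuous_on_subset[OF cont subset_UNIV]]
      by metis
    define t where "t = truncated q (\<lambda>_. 1)"
    have t: "balanced t"
      unfolding t_def by (intro balanced_truncated_polynomial q balanced_const)
    note bt = bounded_borel_balanced[OF t]
    have close: "\<bar>integral\<^sup>L \<rho> g - integral\<^sup>L \<rho> t\<bar> \<le> e / 2" if \<rho>: "\<rho> \<in> {\<mu>, \<nu>}" for \<rho>
    proof -
      interpret prob_space \<rho> using \<rho> prob by auto
      have int: "integrable \<rho> f" if "bounded_borel f" for f
        using \<rho> int that by auto
      have AE: "AE \<theta> in \<rho>. \<bar>g \<theta> - t \<theta>\<bar> \<le> e / 2"
        using fitted_and_support(2)[OF \<rho>]
      proof eventually_elim
        case (elim \<theta>)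
        then show ?case
          using q(2)[of \<theta>] by (simp add: t_def truncated_def)
      qed
      have "\<bar>integral\<^sup>L \<rho> g - integral\<^sup>L \<rho> t\<bar> = \<bar>\<integral>\<theta>. g \<theta> - t \<theta> \<partial>\<rho>\<bar>"
        by (simp add: int bg bt)
      also have "\<dots> \<le> (\<integral>\<theta>. \<bar>g \<theta> - t \<theta>\<bar> \<partial>\<rho>)"
        by (rule integral_abs_bound)
      also have "\<dots> \<le> e / 2"
        by (intro integral_le_const AE integrable_abs int bounded_borel_diff bg bt)
      finally show ?thesis .
    qed
    show ?thesis
      using close[of \<mu>] close[of \<nu>] balanced_integral_eq[OF t]
      unfolding abs_le_iff by simp
  qed
  then show "integral\<^sup>L \<mu> g = integral\<^sup>L \<nu> g"
    using field_le_epsilon[of "\<bar>integral\<^sup>L \<mu> g - integral\<^sup>L \<nu> g\<bar>" 0] by simp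
qed

end

theorem theorem1:
  "AE X in (lebesgue :: (real ^ 'd ^ 'n) measure). \<exists>!\<mu>. is_npmle X \<mu>"
  using AE_subgradient_unique[of potential, OF ex_subgradient_potential]
proof eventually_elim
  case (elim X)
  \<comment> \<open>Existence holds at every \<open>X\<close>; the single subgradient in
    \<open>elim\<close> enters only through uniqueness.\<close>
  obtain \<mu> p R where \<mu>: "is_npmle X \<mu>" and pos: "\<And>i. 0 < p $ i"
    and max: "max_log_likelihood X = (\<Sum>i\<in>UNIV. ln (p $ i))"
    and le: "\<And>\<theta>. (\<Sum>i\<in>UNIV. gauss_at (X $ i) \<theta> / p $ i) \<le> real CARD('n)"
    and less: "\<And>\<theta>. R < norm \<theta> \<Longrightarrow> (\<Sum>i\<in>UNIV. gauss_at (X $ i) \<theta> / p $ i) < real CARD('n)"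
    by (rule npmle_optimality[of X]) blast
  have "\<nu> = \<mu>" if "is_npmle X \<nu>" for \<nu>
  proof -
    interpret two_npmles X \<nu> \<mu> p R
      using that \<mu> pos max le less elim by unfold_locales blast+
    show ?thesis by (rule equal)
  qed
  with \<mu> show ?case by blast
qed

end
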